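(* Let $p$ be a prime positive integer with $p\equiv 1 \pmod 4$, and let $\mathbb{Q}(i)$ be the quadratic field with $i^2=-1$. Let $\alpha$ be an integer which is not a quadratic residue modulo $p$. Then the quaternion algebra $\mathbb{H}_{\mathbb{Q}(i)}(\alpha,p)$ is a division algebra.
   Context: For a field $K$ of characteristic $\neq 2$ and $a,b\in K^{*}$, $\mathbb{H}_K(a,b)$ denotes the generalized quaternion algebra over $K$: the $4$-dimensional central simple $K$-algebra generated by two elements $x,y$ with $x^2=a$, $y^2=b$, $yx=-xy$. It is split if it is isomorphic to the matrix algebra $M_2(K)$ (equivalently, $ax^2+by^2=z^2$ has a nontrivial solution in $K$), and otherwise it is a division algebra. *)

theory Defs
  imports "HOL-Algebra.Algebra" "HOL-Number_Theory.Number_Theory" Complex_Main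
begin

section \<open>Quaternion algebras over a field\<close>

definition center :: "('a, 'm) ring_scheme \<Rightarrow> 'a set" where
  "center A = {z \<in> carrier A. \<forall>u \<in> carrier A. z \<otimes>\<^bsub>A\<^esub> u = u \<otimes>\<^bsub>A\<^esub> z}"

text \<open>
  A unital associative algebra over a field \<open>K\<close> is a ring \<open>A\<close> with a ring homomorphism
  \<open>\<phi>\<close> from \<open>K\<close> to the center of \<open>A\<close>; scalar multiplication is \<open>c \<cdot> u = \<phi> c \<otimes> u\<close>.
  The library locale \<open>algebra\<close> is not usable here, since it requires \<open>A\<close> to be commutative.
\<close>

definition assoc_algebra ::
    "('k, 'n) ring_scheme \<Rightarrow> ('a, 'm) ring_scheme \<Rightarrow> ('k \<Rightarrow> 'a) \<Rightarrow> bool" where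
  "assoc_algebra K A \<phi> \<longleftrightarrow>
     field K \<and> ring A \<and> \<phi> \<in> ring_hom K A \<and> \<phi> ` carrier K \<subseteq> center A"

definition simple_ring :: "('a, 'm) ring_scheme \<Rightarrow> bool" where
  "simple_ring A \<longleftrightarrow>
     ring A \<and> \<one>\<^bsub>A\<^esub> \<noteq> \<zero>\<^bsub>A\<^esub> \<and> (\<forall>I. ideal I A \<longrightarrow> I = {\<zero>\<^bsub>A\<^esub>} \<or> I = carrier A)"

definition central_simple_algebra ::
    "('k, 'n) ring_scheme \<Rightarrow> ('a, 'm) ring_scheme \<Rightarrow> ('k \<Rightarrow> 'a) \<Rightarrow> bool" where
  "central_simple_algebra K A \<phi> \<longleftrightarrow>
     assoc_algebra K A \<phi> \<and> simple_ring A \<and> center A = \<phi> ` carrier K \<and>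
     ring.finite_dimension A (\<phi> ` carrier K) (carrier A)"

definition division_algebra ::
    "('k, 'n) ring_scheme \<Rightarrow> ('a, 'm) ring_scheme \<Rightarrow> ('k \<Rightarrow> 'a) \<Rightarrow> bool" where
  "division_algebra K A \<phi> \<longleftrightarrow>
     assoc_algebra K A \<phi> \<and> \<one>\<^bsub>A\<^esub> \<noteq> \<zero>\<^bsub>A\<^esub> \<and> Units A = carrier A - {\<zero>\<^bsub>A\<^esub>}"

text \<open>
  \<open>quaternion_algebra K a b A \<phi>\<close>: the \<open>K\<close>-algebra \<open>A\<close>, with structure map \<open>\<phi>\<close>, is (a copy of)
  the generalized quaternion algebra of \<open>a\<close> and \<open>b\<close> over \<open>K\<close>.  The predicate \<open>dimension\<close>
  measures \<open>A\<close> over the image of \<open>K\<close> in \<open>A\<close>, and the \<open>K\<close>-subalgebra generated by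
  \<open>x\<close> and \<open>y\<close> is the subring generated by \<open>x\<close>, \<open>y\<close> and that image.
\<close>

definition quaternion_algebra ::
    "('k, 'n) ring_scheme \<Rightarrow> 'k \<Rightarrow> 'k \<Rightarrow> ('a, 'm) ring_scheme \<Rightarrow> ('k \<Rightarrow> 'a) \<Rightarrow> bool" where
  "quaternion_algebra K a b A \<phi> \<longleftrightarrow>
     field K \<and> \<one>\<^bsub>K\<^esub> \<oplus>\<^bsub>K\<^esub> \<one>\<^bsub>K\<^esub> \<noteq> \<zero>\<^bsub>K\<^esub> \<and>
     a \<in> carrier K - {\<zero>\<^bsub>K\<^esub>} \<and> b \<in> carrier K - {\<zero>\<^bsub>K\<^esub>} \<and>
     central_simple_algebra K A \<phi> \<and>
     ring.dimension A 4 (\<phi> ` carrier K) (carrier A) \<and>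
     (\<exists>x \<in> carrier A. \<exists>y \<in> carrier A.
        x [^]\<^bsub>A\<^esub> (2::nat) = \<phi> a \<and> y [^]\<^bsub>A\<^esub> (2::nat) = \<phi> b \<and>
        y \<otimes>\<^bsub>A\<^esub> x = \<ominus>\<^bsub>A\<^esub> (x \<otimes>\<^bsub>A\<^esub> y) \<and>
        generate_ring A (\<phi> ` carrier K \<union> {x, y}) = carrier A)"


section \<open>The field of Gaussian numbers\<close>

definition Gauss_numbers :: "complex set" where
  "Gauss_numbers = {of_rat r + of_rat s * \<i> | r s. True}"

definition Q_i :: "complex ring" where
  "Q_i = \<lparr>carrier = Gauss_numbers, monoid.mult = (*), one = 1, ring.zero = 0, add = (+)\<rparr>"

lemma Q_i_simps [simp]:
  "carrier Q_i = Gauss_numbers" "x \<otimes>\<^bsub>Q_i\<^esub> y = x * y" "\<one>\<^bsub>Q_i\<^esub> = 1"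
  "\<zero>\<^bsub>Q_i\<^esub> = 0" "x \<oplus>\<^bsub>Q_i\<^esub> y = x + y"
  by (simp_all add: Q_i_def)

lemma of_rat_complex: "of_rat q = complex_of_real (of_rat q)"
  by (cases q) (simp add: of_rat_rat)

lemma Gauss_numbers_iff: "z \<in> Gauss_numbers \<longleftrightarrow> Re z \<in> \<rat> \<and> Im z \<in> \<rat>"
proof
  assume "z \<in> Gauss_numbers"
  then obtain r s where z: "z = of_rat r + of_rat s * \<i>"
    by (auto simp: Gauss_numbers_def)
  then show "Re z \<in> \<rat> \<and> Im z \<in> \<rat>"
    by (simp add: of_rat_complex)
next
  assume "Re z \<in> \<rat> \<and> Im z \<in> \<rat>"
  then obtain r s where "Re z = of_rat r" "Im z = of_rat s"
    by (auto elim!: Rats_cases)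
  then have "z = of_rat r + of_rat s * \<i>"
    by (simp add: of_rat_complex complex_eq_iff)
  then show "z \<in> Gauss_numbers"
    by (auto simp: Gauss_numbers_def)
qed

lemma Gauss_numbers_closed [simp, intro]:
  "0 \<in> Gauss_numbers" "1 \<in> Gauss_numbers"
  "of_int n \<in> Gauss_numbers" "of_nat m \<in> Gauss_numbers" "numeral w \<in> Gauss_numbers"
  "x \<in> Gauss_numbers \<Longrightarrow> - x \<in> Gauss_numbers"
  "x \<in> Gauss_numbers \<Longrightarrow> y \<in> Gauss_numbers \<Longrightarrow> x + y \<in> Gauss_numbers"
  "x \<in> Gauss_numbers \<Longrightarrow> y \<in> Gauss_numbers \<Longrightarrow> x - y \<in> Gauss_numbers"
  "x \<in> Gauss_numbers \<Longrightarrow> y \<in> Gauss_numbers \<Longrightarrow> x * y \<in> Gauss_numbers"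
  "x \<in> Gauss_numbers \<Longrightarrow> inverse x \<in> Gauss_numbers"
  "x \<in> Gauss_numbers \<Longrightarrow> y \<in> Gauss_numbers \<Longrightarrow> x / y \<in> Gauss_numbers"
  unfolding Gauss_numbers_iff by (auto simp: Re_divide Im_divide)

lemma field_Q_i: "field Q_i"
proof -
  have "cring Q_i"
  proof (rule cringI)
    show "abelian_group Q_i"
    proof (rule abelian_groupI)
      show "\<exists>y \<in> carrier Q_i. y \<oplus>\<^bsub>Q_i\<^esub> x = \<zero>\<^bsub>Q_i\<^esub>" if "x \<in> carrier Q_i" for x
        using that by (intro bexI[of _ "- x"]) auto
    qed (auto simp: algebra_simps)
    show "comm_monoid Q_i"
      by (rule comm_monoidI) (auto simp: algebra_simps)
  qed (auto simp: algebra_simps)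
  then show ?thesis
  proof (rule cring.cring_fieldI2)
    show "\<exists>y \<in> carrier Q_i. x \<otimes>\<^bsub>Q_i\<^esub> y = \<one>\<^bsub>Q_i\<^esub>"
      if "x \<in> carrier Q_i" "x \<noteq> \<zero>\<^bsub>Q_i\<^esub>" for x
      using that by (intro bexI[of _ "inverse x"]) auto
  qed auto
qed


section \<open>Existence of quaternion algebras over the Gaussian numbers\<close>

text \<open>
  The quadruple \<open>(t, u, v, w)\<close> stands for \<open>t + u x + v y + w x y\<close>.  The lemma at the end shows
  that the hypotheses collected in \<open>quaternion_algebra\<close> are satisfiable over \<open>Q_i\<close> for all
  nonzero parameters.
\<close>

fun quat_mult :: "complex \<Rightarrow> complex \<Rightarrow> complex \<times> complex \<times> complex \<times> complex \<Rightarrow>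
    complex \<times> complex \<times> complex \<times> complex \<Rightarrow> complex \<times> complex \<times> complex \<times> complex" where
  "quat_mult a b (t, u, v, w) (t', u', v', w') =
     (t * t' + a * u * u' + b * v * v' - a * b * w * w',
      t * u' + u * t' - b * v * w' + b * w * v',
      t * v' + v * t' + a * u * w' - a * w * u',
      t * w' + w * t' + u * v' - v * u')"

fun quat_add :: "complex \<times> complex \<times> complex \<times> complex \<Rightarrow>
    complex \<times> complex \<times> complex \<times> complex \<Rightarrow> complex \<times> complex \<times> complex \<times> complex" where
  "quat_add (t, u, v, w) (t', u', v', w') = (t + t', u + u', v + v', w + w')"

definition quat :: "complex \<Rightarrow> complex \<Rightarrow> (complex \<times> complex \<times> complex \<times> complex) ring" where
  "quat a b =
     \<lparr>carrier = Gauss_numbers \<times> Gauss_numbers \<times> Gauss_numbers \<times> Gauss_numbers,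
      monoid.mult = quat_mult a b, one = (1, 0, 0, 0), ring.zero = (0, 0, 0, 0), add = quat_add\<rparr>"

definition quat_of :: "complex \<Rightarrow> complex \<times> complex \<times> complex \<times> complex" where
  "quat_of c = (c, 0, 0, 0)"

lemma quat_simps [simp]:
  "carrier (quat a b) = Gauss_numbers \<times> Gauss_numbers \<times> Gauss_numbers \<times> Gauss_numbers"
  "x \<otimes>\<^bsub>quat a b\<^esub> y = quat_mult a b x y" "\<one>\<^bsub>quat a b\<^esub> = (1, 0, 0, 0)"
  "\<zero>\<^bsub>quat a b\<^esub> = (0, 0, 0, 0)" "x \<oplus>\<^bsub>quat a b\<^esub> y = quat_add x y"
  by (simp_all add: quat_def)

lemma ring_quat:
  assumes "a \<in> Gauss_numbers" "b \<in> Gauss_numbers"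
  shows "ring (quat a b)"
proof (rule ringI)
  show "abelian_group (quat a b)"
  proof (rule abelian_groupI)
    show "\<exists>y \<in> carrier (quat a b). y \<oplus>\<^bsub>quat a b\<^esub> x = \<zero>\<^bsub>quat a b\<^esub>"
      if "x \<in> carrier (quat a b)" for x
    proof -
      obtain t u v w where "x = (t, u, v, w)" by (cases x)
      then show ?thesis
        using that by (intro bexI[of _ "(- t, - u, - v, - w)"]) auto
    qed
  qed (auto simp: algebra_simps)
  show "monoid (quat a b)"
    by (rule monoidI) (use assms in \<open>auto simp: algebra_simps\<close>)
qed (auto simp: algebra_simps)

lemma quat_minus:
  assumes "a \<in> Gauss_numbers" "b \<in> Gauss_numbers"
    "t \<in> Gauss_numbers" "u \<in> Gauss_numbers" "v \<in> Gauss_numbers" "w \<in> Gauss_numbers"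
  shows "\<ominus>\<^bsub>quat a b\<^esub> (t, u, v, w) = (- t, - u, - v, - w)"
proof -
  interpret ring "quat a b" using ring_quat assms by blast
  have "(- t, - u, - v, - w) \<oplus>\<^bsub>quat a b\<^esub> (t, u, v, w) = \<zero>\<^bsub>quat a b\<^esub>" by simp
  then show ?thesis
    using assms by (intro minus_equality) auto
qed

lemma center_quat:
  assumes "a \<in> Gauss_numbers - {0}" "b \<in> Gauss_numbers - {0}"
  shows "center (quat a b) = quat_of ` Gauss_numbers"
proof
  show "quat_of ` Gauss_numbers \<subseteq> center (quat a b)"
    by (auto simp: center_def quat_of_def algebra_simps)
  show "center (quat a b) \<subseteq> quat_of ` Gauss_numbers"
  proof
    fix z assume z: "z \<in> center (quat a b)"
    obtain t u v w where zeq: "z = (t, u, v, w)" by (cases z)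
    have "quat_mult a b z (0, 1, 0, 0) = quat_mult a b (0, 1, 0, 0) z"
      "quat_mult a b z (0, 0, 1, 0) = quat_mult a b (0, 0, 1, 0) z"
      using z by (auto simp: center_def)
    then have "u = 0" "v = 0" "w = 0"
      using assms zeq by auto
    then show "z \<in> quat_of ` Gauss_numbers"
      using z zeq by (auto simp: center_def quat_of_def)
  qed
qed

lemma simple_ring_quat:
  assumes "a \<in> Gauss_numbers - {0}" "b \<in> Gauss_numbers - {0}"
  shows "simple_ring (quat a b)"
proof -
  let ?G = Gauss_numbers
  interpret ring "quat a b" using ring_quat assms by blast
  have "I = carrier (quat a b)" if I: "ideal I (quat a b)" and ne: "I \<noteq> {\<zero>\<^bsub>quat a b\<^esub>}" for I
  proof -
    interpret ideal I "quat a b" by fact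
    have sub: "z \<in> ?G \<times> ?G \<times> ?G \<times> ?G" if "z \<in> I" for z
      using that Icarr by simp
    have l: "quat_mult a b r z \<in> I" if "z \<in> I" "r \<in> ?G \<times> ?G \<times> ?G \<times> ?G" for z r
      using I_l_closed[OF that(1)] that(2) by simp
    have r: "quat_mult a b z r \<in> I" if "z \<in> I" "r \<in> ?G \<times> ?G \<times> ?G \<times> ?G" for z r
      using I_r_closed[OF that(1)] that(2) by simp
    have ad: "quat_add z z' \<in> I" if "z \<in> I" "z' \<in> I" for z z'
      using a_closed[OF that] by simp
    have fst_mem: "(t, 0, 0, 0) \<in> I" if z: "(t, u, v, w) \<in> I" for t u v w
    proof -
      have "(t, u, - v, - w) \<in> I"
        using r[OF l[OF z, of "(0, inverse a, 0, 0)"], of "(0, 1, 0, 0)"] assms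
        by (simp add: mult.assoc [symmetric])
      from ad[OF z this] have "(2 * t, 2 * u, 0, 0) \<in> I"
        by simp
      from ad[OF this r[OF l[OF this, of "(0, 0, inverse b, 0)"], of "(0, 0, 1, 0)"]]
      have "(4 * t, 0, 0, 0) \<in> I"
        using assms by (simp add: mult.assoc [symmetric])
      from l[OF this, of "(inverse 4, 0, 0, 0)"] show ?thesis
        by simp
    qed
    have "\<exists>z \<in> I. z \<noteq> (0, 0, 0, 0)"
      using ne additive_subgroup.zero_closed[OF is_additive_subgroup]
      by (auto simp del: split_paired_All split_paired_Ex)
    then obtain t u v w where z: "(t, u, v, w) \<in> I" and nz: "(t, u, v, w) \<noteq> (0, 0, 0, 0)"
      by auto
    have "(t, 0, 0, 0) \<in> I"
      by (rule fst_mem[OF z])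
    moreover have "(a * u, 0, 0, 0) \<in> I"
      using fst_mem r[OF z, of "(0, 1, 0, 0)"] by simp
    moreover have "(b * v, 0, 0, 0) \<in> I"
      using fst_mem r[OF z, of "(0, 0, 1, 0)"] by simp
    moreover have "(- (a * b * w), 0, 0, 0) \<in> I"
      using fst_mem r[OF z, of "(0, 0, 0, 1)"] by simp
    ultimately obtain c where c: "(c, 0, 0, 0) \<in> I" "c \<noteq> 0"
      using nz assms by (cases "t = 0"; cases "u = 0"; cases "v = 0"; force)
    have "quat_mult a b (inverse c, 0, 0, 0) (c, 0, 0, 0) \<in> I"
      by (rule l) (use c sub[OF c(1)] in auto)
    then have "\<one>\<^bsub>quat a b\<^esub> \<in> I"
      using c by simp
    then show ?thesis
      using one_imp_carrier by simp
  qed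
  then show ?thesis
    using ring_axioms by (auto simp: simple_ring_def)
qed

lemma dimension_quat:
  assumes "a \<in> Gauss_numbers" "b \<in> Gauss_numbers"
  shows "ring.dimension (quat a b) 4 (quat_of ` Gauss_numbers) (carrier (quat a b))"
proof -
  let ?G = Gauss_numbers and ?K = "quat_of ` Gauss_numbers"
  interpret ring "quat a b" using ring_quat assms by blast
  have ext: "z \<in> line_extension ?K v E \<longleftrightarrow>
      (\<exists>c \<in> ?G. \<exists>e \<in> E. z = quat_add (quat_mult a b (quat_of c) v) e)" for z v E
    by (simp add: line_extension_mem_iff)
  have d0: "dimension 0 ?K ({0} \<times> {0} \<times> {0} \<times> {0})"
    using zero_dim[of ?K] by simp
  have "line_extension ?K (0, 0, 0, 1) ({0} \<times> {0} \<times> {0} \<times> {0}) = {0} \<times> {0} \<times> {0} \<times> ?G"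
    by (intro Set.set_eqI, unfold ext) (auto simp: quat_of_def)
  with Suc_dim[OF _ _ d0, of "(0, 0, 0, 1)"] have d1: "dimension 1 ?K ({0} \<times> {0} \<times> {0} \<times> ?G)"
    by (simp add: eval_nat_numeral)
  have "line_extension ?K (0, 0, 1, 0) ({0} \<times> {0} \<times> {0} \<times> ?G) = {0} \<times> {0} \<times> ?G \<times> ?G"
    by (intro Set.set_eqI, unfold ext) (auto simp: quat_of_def)
  with Suc_dim[OF _ _ d1, of "(0, 0, 1, 0)"] have d2: "dimension 2 ?K ({0} \<times> {0} \<times> ?G \<times> ?G)"
    by (simp add: eval_nat_numeral)
  have "line_extension ?K (0, 1, 0, 0) ({0} \<times> {0} \<times> ?G \<times> ?G) = {0} \<times> ?G \<times> ?G \<times> ?G"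
    by (intro Set.set_eqI, unfold ext) (auto simp: quat_of_def)
  with Suc_dim[OF _ _ d2, of "(0, 1, 0, 0)"] have d3: "dimension 3 ?K ({0} \<times> ?G \<times> ?G \<times> ?G)"
    by (simp add: eval_nat_numeral)
  have "line_extension ?K (1, 0, 0, 0) ({0} \<times> ?G \<times> ?G \<times> ?G) = ?G \<times> ?G \<times> ?G \<times> ?G"
    by (intro Set.set_eqI, unfold ext) (auto simp: quat_of_def)
  with Suc_dim[OF _ _ d3, of "(1, 0, 0, 0)"] have d4: "dimension 4 ?K (?G \<times> ?G \<times> ?G \<times> ?G)"
    by (simp add: eval_nat_numeral)
  from d4 show ?thesis by simp
qed

lemma generate_quat:
  assumes "a \<in> Gauss_numbers" "b \<in> Gauss_numbers"
  shows "generate_ring (quat a b) (quat_of ` Gauss_numbers \<union> {(0, 1, 0, 0), (0, 0, 1, 0)})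
    = carrier (quat a b)" (is "generate_ring _ ?H = _")
proof
  interpret ring "quat a b" using ring_quat assms by blast
  show "generate_ring (quat a b) ?H \<subseteq> carrier (quat a b)"
    by (rule generate_ring_incl) (auto simp: quat_of_def)
  show "carrier (quat a b) \<subseteq> generate_ring (quat a b) ?H"
  proof
    fix z assume "z \<in> carrier (quat a b)"
    then obtain t u v w where z: "z = (t, u, v, w)"
      "t \<in> Gauss_numbers" "u \<in> Gauss_numbers" "v \<in> Gauss_numbers" "w \<in> Gauss_numbers"
      by auto
    let ?x = "(0, 1, 0, 0)" and ?y = "(0, 0, 1, 0)"
    have "quat_of t \<oplus>\<^bsub>quat a b\<^esub> (quat_of u \<otimes>\<^bsub>quat a b\<^esub> ?x \<oplus>\<^bsub>quat a b\<^esub>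
        (quat_of v \<otimes>\<^bsub>quat a b\<^esub> ?y \<oplus>\<^bsub>quat a b\<^esub>
          quat_of w \<otimes>\<^bsub>quat a b\<^esub> (?x \<otimes>\<^bsub>quat a b\<^esub> ?y))) \<in> generate_ring (quat a b) ?H"
      by (intro generate_ring.eng_add generate_ring.eng_mult generate_ring.incl) (use z in auto)
    then show "z \<in> generate_ring (quat a b) ?H"
      by (simp add: quat_of_def z)
  qed
qed

lemma quaternion_algebra_quat:
  assumes "a \<in> Gauss_numbers - {0}" "b \<in> Gauss_numbers - {0}"
  shows "quaternion_algebra Q_i a b (quat a b) quat_of"
proof -
  have ab: "a \<in> Gauss_numbers" "b \<in> Gauss_numbers"
    using assms by auto
  interpret ring "quat a b" using ring_quat[OF ab] .
  have "quat_of \<in> ring_hom Q_i (quat a b)"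
    by (rule ring_hom_memI) (auto simp: quat_of_def)
  then have alg: "assoc_algebra Q_i (quat a b) quat_of"
    using field_Q_i ring_axioms center_quat[OF assms] by (simp add: assoc_algebra_def)
  have csa: "central_simple_algebra Q_i (quat a b) quat_of"
    using alg simple_ring_quat[OF assms] center_quat[OF assms] dimension_quat[OF ab]
    by (auto simp: central_simple_algebra_def finite_dimension_def simp del: quat_simps)
  have "(0, 1, 0, 0) [^]\<^bsub>quat a b\<^esub> (2::nat) = quat_of a"
    "(0, 0, 1, 0) [^]\<^bsub>quat a b\<^esub> (2::nat) = quat_of b"
    by (simp_all add: numeral_2_eq_2 quat_of_def)
  moreover have "(0, 0, 1, 0) \<otimes>\<^bsub>quat a b\<^esub> (0, 1, 0, 0) =
      \<ominus>\<^bsub>quat a b\<^esub> ((0, 1, 0, 0) \<otimes>\<^bsub>quat a b\<^esub> (0, 0, 1, 0))"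
    using ab by (simp add: quat_minus)
  moreover have "(0, 1, 0, 0) \<in> carrier (quat a b)" "(0, 0, 1, 0) \<in> carrier (quat a b)"
    by auto
  ultimately have "\<exists>x \<in> carrier (quat a b). \<exists>y \<in> carrier (quat a b).
      x [^]\<^bsub>quat a b\<^esub> (2::nat) = quat_of a \<and> y [^]\<^bsub>quat a b\<^esub> (2::nat) = quat_of b \<and>
      y \<otimes>\<^bsub>quat a b\<^esub> x = \<ominus>\<^bsub>quat a b\<^esub> (x \<otimes>\<^bsub>quat a b\<^esub> y) \<and>
      generate_ring (quat a b) (quat_of ` carrier Q_i \<union> {x, y}) = carrier (quat a b)"
    using generate_quat[OF ab] unfolding Q_i_simps by blast
  then show ?thesis
    using field_Q_i csa dimension_quat[OF ab] assms
    by (auto simp: quaternion_algebra_def simp del: quat_simps)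
qed

end

theory Submission
  imports Defs
begin

text \<open>
  The map sending \<open>(t, u, v, w)\<close> to \<open>t + u x + v y + w x y\<close> is a surjective ring homomorphism from
  \<open>quat a b\<close> onto any quaternion algebra, so it suffices that the norm form
  \<open>t\<^sup>2 - \<alpha> u\<^sup>2 - p v\<^sup>2 + \<alpha> p w\<^sup>2\<close> is anisotropic over the Gaussian numbers.
  Clear denominators and choose \<open>j\<close> with \<open>j\<^sup>2 = - 1\<close> modulo \<open>p\<close> and \<open>0 \<le> j < p\<close>.
  The map \<open>m + n i \<mapsto> m + n j\<close> reduces the Gaussian integers modulo a prime above \<open>p\<close>. As \<open>\<alpha>\<close> is
  a nonresidue, this reduction kills \<open>t\<close> and \<open>u\<close> and then also \<open>v\<close> and \<open>w\<close>.
  Multiplying the solution by \<open>(j + i) / p\<close> therefore gives another integral one, whose size is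
  smaller by the factor \<open>(j\<^sup>2 + 1) / p\<^sup>2 < 1\<close>; infinite descent leaves only the zero solution.
\<close>

section \<open>Descent in the Gaussian integers\<close>

text \<open>Euler's criterion applies with the even exponent \<open>(p - 1) / 2\<close>. Reducing
  the root modulo \<open>p\<close> gives \<open>j < p\<close>, which later makes the descent
  strict.\<close>

lemma sqrt_minus_one_mod_prime:
  assumes "Factorial_Ring.prime p" "[p = 1] (mod 4)"
  obtains j :: int where "0 \<le> j" "j < int p" "int p dvd j\<^sup>2 + 1"
proof -
  have "p \<noteq> 2"
    using assms(2) by (auto simp: cong_def)
  then have p2: "2 < p"
    using prime_ge_2_nat[OF assms(1)] by linarith
  obtain k where "p = 4 * k + 1"
    using assms(2) p2 by (metis cong_def mod_mult_div_eq mod_less one_less_numeral_iff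
      semiring_norm(76) add.commute)
  then have "even ((p - 1) div 2)"
    by simp
  then have "[Legendre (- 1) (int p) = 1] (mod int p)"
    using euler_criterion[OF assms(1) p2, of "- 1"] by simp
  \<comment> \<open>Since \<open>p > 2\<close>, the other two values of the Legendre symbol, -1 and
    0, are not congruent to 1.\<close>
  moreover have "\<not> [- 1 = 1] (mod int p)" "\<not> [0 = 1] (mod int p)"
    using p2 by (auto simp: cong_iff_dvd_diff dest!: zdvd_imp_le)
  ultimately have "QuadRes (int p) (- 1)"
    by (auto simp: Legendre_def split: if_splits)
  then obtain y where "[y\<^sup>2 = - 1] (mod int p)"
    by (auto simp: QuadRes_def)
  then have "[(y mod int p)\<^sup>2 = - 1] (mod int p)"
    by (simp add: cong_def power_mod)
  then show ?thesis
    using that[of "y mod int p"] p2 by (simp add: cong_iff_dvd_diff)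
qed

text \<open>If \<open>r\<close> were invertible modulo \<open>p\<close>, then \<open>s / r\<close>
  would be a square root of \<open>\<alpha>\<close>. So \<open>p\<close> divides \<open>r\<close>,
  hence \<open>s^2\<close>, hence \<open>s\<close>.\<close>

lemma nonresidue_dvd:
  fixes p \<alpha> s r :: int
  assumes "Factorial_Ring.prime p" "\<not> QuadRes p \<alpha>" "p dvd s\<^sup>2 - \<alpha> * r\<^sup>2"
  shows "p dvd s" "p dvd r"
proof -
  show "p dvd r"
  proof (rule ccontr)
    assume "\<not> p dvd r"
    then have "coprime r p"
      using assms(1) by (simp add: prime_imp_coprime coprime_commute)
    then obtain r' where "[r * r' = 1] (mod p)"
      using cong_solve_coprime_int by blast
    then have "[\<alpha> * (r * r')\<^sup>2 = \<alpha> * 1\<^sup>2] (mod p)"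
      by (intro cong_mult cong_pow cong_refl)
    moreover have "[s\<^sup>2 * r'\<^sup>2 = \<alpha> * r\<^sup>2 * r'\<^sup>2] (mod p)"
      using assms(3) by (intro cong_mult cong_refl) (simp add: cong_iff_dvd_diff)
    ultimately have "[(s * r')\<^sup>2 = \<alpha>] (mod p)"
      by (auto simp: power_mult_distrib mult.assoc intro: cong_trans)
    then show False
      using assms(2) by (auto simp: QuadRes_def)
  qed
  then have "p dvd s\<^sup>2"
    using assms(3) by (auto simp: power2_eq_square dvd_diff_left_iff)
  then show "p dvd s"
    using assms(1) prime_dvd_power by blast
qed

text \<open>Multiplication of \<open>m + n i\<close> by \<open>(j + i) / p\<close>.\<close>

lemma rotate:
  fixes p j m n :: int
  assumes "p dvd j\<^sup>2 + 1" "p dvd m + j * n"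
  obtains m' n' where "p * m' = j * m - n" "p * n' = m + j * n"
proof -
  \<comment> \<open>The product \<open>(m + n i) (j + i)\<close> is
    \<open>(j m - n) + (m + j n) i\<close>. Its imaginary part is divisible by assumption, and
    modulo \<open>p\<close> its real part is \<open>j\<close> times the imaginary one.\<close>
  have "j * m - n = j * (m + j * n) - n * (j\<^sup>2 + 1)"
    by (simp add: algebra_simps power2_eq_square)
  then have "p dvd j * m - n"
    using assms by (metis dvd_diff dvd_mult)
  then show ?thesis
    using assms(2) that by (metis dvd_def)
qed

text \<open>
  The real part and half the imaginary part of \<open>(m + n i)\<^sup>2 - \<alpha> (k + l i)\<^sup>2\<close>.
\<close>

definition form_re :: "int \<Rightarrow> int \<Rightarrow> int \<Rightarrow> int \<Rightarrow> int \<Rightarrow> int" where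
  "form_re \<alpha> m n k l = m\<^sup>2 - n\<^sup>2 - \<alpha> * (k\<^sup>2 - l\<^sup>2)"

definition form_im :: "int \<Rightarrow> int \<Rightarrow> int \<Rightarrow> int \<Rightarrow> int \<Rightarrow> int" where
  "form_im \<alpha> m n k l = m * n - \<alpha> * (k * l)"

text \<open>By homogeneity the value \<open>form_re + 2 form_im i\<close> gets multiplied by
  \<open>(j + i)^2 = (j^2 - 1) + 2 j i\<close>, up to the denominator \<open>p^2\<close>.\<close>

lemma form_rotate:
  fixes p :: int
  assumes "p * m' = j * m - n" "p * n' = m + j * n" "p * k' = j * k - l" "p * l' = k + j * l"
  shows "p\<^sup>2 * form_re \<alpha> m' n' k' l' = (j\<^sup>2 - 1) * form_re \<alpha> m n k l - 4 * j * form_im \<alpha> m n k l"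
    and "p\<^sup>2 * form_im \<alpha> m' n' k' l' = (j\<^sup>2 - 1) * form_im \<alpha> m n k l + j * form_re \<alpha> m n k l"
proof -
  have "p\<^sup>2 * form_re \<alpha> m' n' k' l' = form_re \<alpha> (p * m') (p * n') (p * k') (p * l')"
    by (simp add: form_re_def algebra_simps power2_eq_square)
  also have "\<dots> = (j\<^sup>2 - 1) * form_re \<alpha> m n k l - 4 * j * form_im \<alpha> m n k l"
    unfolding assms by (simp add: form_re_def form_im_def algebra_simps power2_eq_square)
  finally show "p\<^sup>2 * form_re \<alpha> m' n' k' l' = \<dots>" .
  have "p\<^sup>2 * form_im \<alpha> m' n' k' l' = form_im \<alpha> (p * m') (p * n') (p * k') (p * l')"
    by (simp add: form_im_def algebra_simps power2_eq_square)
  also have "\<dots> = (j\<^sup>2 - 1) * form_im \<alpha> m n k l + j * form_re \<alpha> m n k l"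
    unfolding assms by (simp add: form_re_def form_im_def algebra_simps power2_eq_square)
  finally show "p\<^sup>2 * form_im \<alpha> m' n' k' l' = \<dots>" .
qed

lemma norm_rotate:
  fixes p :: int
  assumes "p * m' = j * m - n" "p * n' = m + j * n"
  shows "p\<^sup>2 * (m'\<^sup>2 + n'\<^sup>2) = (j\<^sup>2 + 1) * (m\<^sup>2 + n\<^sup>2)"
proof -
  have "p\<^sup>2 * (m'\<^sup>2 + n'\<^sup>2) = (p * m')\<^sup>2 + (p * n')\<^sup>2"
    by (simp add: algebra_simps power2_eq_square)
  also have "\<dots> = (j\<^sup>2 + 1) * (m\<^sup>2 + n\<^sup>2)"
    unfolding assms by (simp add: algebra_simps power2_eq_square)
  finally show ?thesis .
qed

text \<open>The last assumption concerns the image of the form's value under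
  \<open>i \<mapsto> j\<close>; modulo \<open>p\<close> this image is the same form in the reduced
  arguments, so \<open>nonresidue_dvd\<close> applies.\<close>

lemma form_reduction_dvd:
  fixes p \<alpha> :: int
  assumes "Factorial_Ring.prime p" "\<not> QuadRes p \<alpha>" "p dvd j\<^sup>2 + 1"
    and "p dvd form_re \<alpha> m n k l + 2 * j * form_im \<alpha> m n k l"
  shows "p dvd m + j * n" "p dvd k + j * l"
proof -
  have "(m + j * n)\<^sup>2 - \<alpha> * (k + j * l)\<^sup>2 =
      (form_re \<alpha> m n k l + 2 * j * form_im \<alpha> m n k l) + (j\<^sup>2 + 1) * (n\<^sup>2 - \<alpha> * l\<^sup>2)"
    by (simp add: form_re_def form_im_def algebra_simps power2_eq_square)
  then have "p dvd (m + j * n)\<^sup>2 - \<alpha> * (k + j * l)\<^sup>2"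
    using assms(3,4) by simp
  then show "p dvd m + j * n" "p dvd k + j * l"
    using nonresidue_dvd[OF assms(1,2)] by blast+
qed

text \<open>Strong induction on the sum of the eight squares: rotating all four Gaussian integers by
  \<open>(j + i) / p\<close> gives a solution with a smaller sum.\<close>

lemma form_anisotropic:
  fixes p \<alpha> j :: int
  assumes p: "Factorial_Ring.prime p" "odd p" and nr: "\<not> QuadRes p \<alpha>"
    and j: "0 \<le> j" "j < p" "p dvd j\<^sup>2 + 1"
    and re: "form_re \<alpha> t1 t2 u1 u2 = p * form_re \<alpha> v1 v2 w1 w2"
    and im: "form_im \<alpha> t1 t2 u1 u2 = p * form_im \<alpha> v1 v2 w1 w2"
  shows "t1\<^sup>2 + t2\<^sup>2 + (u1\<^sup>2 + u2\<^sup>2) + (v1\<^sup>2 + v2\<^sup>2) + (w1\<^sup>2 + w2\<^sup>2) = 0"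
  using re im
proof (induction "nat (t1\<^sup>2 + t2\<^sup>2 + (u1\<^sup>2 + u2\<^sup>2) + (v1\<^sup>2 + v2\<^sup>2) + (w1\<^sup>2 + w2\<^sup>2))"
    arbitrary: t1 t2 u1 u2 v1 v2 w1 w2 rule: less_induct)
  case less
  let ?S = "t1\<^sup>2 + t2\<^sup>2 + (u1\<^sup>2 + u2\<^sup>2) + (v1\<^sup>2 + v2\<^sup>2) + (w1\<^sup>2 + w2\<^sup>2)"
  have p0: "p > 0"
    using p(1) prime_gt_0_int by blast
  have "p dvd form_re \<alpha> t1 t2 u1 u2 + 2 * j * form_im \<alpha> t1 t2 u1 u2"
    unfolding less.prems by simp
  note tu = form_reduction_dvd[OF p(1) nr j(3) this]
  obtain t1' t2' where t: "p * t1' = j * t1 - t2" "p * t2' = t1 + j * t2"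
    using rotate[OF j(3) tu(1)] .
  obtain u1' u2' where u: "p * u1' = j * u1 - u2" "p * u2' = u1 + j * u2"
    using rotate[OF j(3) tu(2)] .
  define Y1 Y2 where "Y1 = form_re \<alpha> v1 v2 w1 w2" and "Y2 = form_im \<alpha> v1 v2 w1 w2"
  \<comment> \<open>\<open>X1\<close> and \<open>X2\<close> say that \<open>p\<close> times the
    rotated left-hand form is \<open>(j + i)^2 (Y1 + 2 Y2 i)\<close>: one of the two factors
    \<open>p\<close> cancels against the one in the equation.\<close>
  have X1: "p * form_re \<alpha> t1' t2' u1' u2' = (j\<^sup>2 - 1) * Y1 - 4 * j * Y2"
  proof -
    have "p * (p * form_re \<alpha> t1' t2' u1' u2') = p * ((j\<^sup>2 - 1) * Y1 - 4 * j * Y2)"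
      unfolding mult.assoc[symmetric] power2_eq_square[symmetric] form_rotate(1)[OF t u]
      by (simp add: less.prems Y1_def Y2_def algebra_simps)
    then show ?thesis using p0 by simp
  qed
  have X2: "p * form_im \<alpha> t1' t2' u1' u2' = (j\<^sup>2 - 1) * Y2 + j * Y1"
  proof -
    have "p * (p * form_im \<alpha> t1' t2' u1' u2') = p * ((j\<^sup>2 - 1) * Y2 + j * Y1)"
      unfolding mult.assoc[symmetric] power2_eq_square[symmetric] form_rotate(2)[OF t u]
      by (simp add: less.prems Y1_def Y2_def algebra_simps)
    then show ?thesis using p0 by simp
  qed
  \<comment> \<open>Under \<open>i \<mapsto> j\<close> the factor \<open>(j + i)^2\<close> becomes
    \<open>4 j^2\<close>, which is -4 modulo \<open>p\<close>. Reducing \<open>X1\<close> and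
    \<open>X2\<close> thus shows that \<open>p\<close> divides four times the image of
    \<open>Y1 + 2 Y2 i\<close>.\<close>
  have "4 * (Y1 + 2 * j * Y2) = (j\<^sup>2 + 1) * (3 * Y1 + 2 * j * Y2)
      - ((j\<^sup>2 - 1) * Y1 - 4 * j * Y2) - 2 * j * ((j\<^sup>2 - 1) * Y2 + j * Y1)"
    by (simp add: algebra_simps power2_eq_square)
  also have "p dvd \<dots>"
    unfolding X1[symmetric] X2[symmetric] using j(3) by simp
  finally have "p dvd 2 ^ 2 * (Y1 + 2 * j * Y2)"
    by simp
  \<comment> \<open>Oddness of \<open>p\<close> allows cancelling the 4.\<close>
  moreover have "\<not> p dvd 2 ^ 2"
    using p prime_dvd_power[OF p(1), of 2 2] primes_dvd_imp_eq[OF p(1), of 2] by auto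
  ultimately have "p dvd Y1 + 2 * j * Y2"
    using p(1) prime_dvd_mult_iff by blast
  note vw = form_reduction_dvd[OF p(1) nr j(3) this[unfolded Y1_def Y2_def]]
  obtain v1' v2' where v: "p * v1' = j * v1 - v2" "p * v2' = v1 + j * v2"
    using rotate[OF j(3) vw(1)] .
  obtain w1' w2' where w: "p * w1' = j * w1 - w2" "p * w2' = w1 + j * w2"
    using rotate[OF j(3) vw(2)] .
  \<comment> \<open>Now \<open>v\<close> and \<open>w\<close> can be rotated too, and the right-hand
    sides of \<open>X1\<close> and \<open>X2\<close> are \<open>p^2\<close> times the rotated forms;
    cancelling \<open>p\<close> restores the original equations.\<close>
  have "p * form_re \<alpha> t1' t2' u1' u2' = p * (p * form_re \<alpha> v1' v2' w1' w2')"
    unfolding X1 Y1_def Y2_def form_rotate(1)[OF v w, symmetric] by (simp add: power2_eq_square)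
  then have re': "form_re \<alpha> t1' t2' u1' u2' = p * form_re \<alpha> v1' v2' w1' w2'"
    using p0 by simp
  have "p * form_im \<alpha> t1' t2' u1' u2' = p * (p * form_im \<alpha> v1' v2' w1' w2')"
    unfolding X2 Y1_def Y2_def form_rotate(2)[OF v w, symmetric] by (simp add: power2_eq_square)
  then have im': "form_im \<alpha> t1' t2' u1' u2' = p * form_im \<alpha> v1' v2' w1' w2'"
    using p0 by simp
  let ?S' = "t1'\<^sup>2 + t2'\<^sup>2 + (u1'\<^sup>2 + u2'\<^sup>2) + (v1'\<^sup>2 + v2'\<^sup>2) + (w1'\<^sup>2 + w2'\<^sup>2)"
  have S: "p\<^sup>2 * ?S' = (j\<^sup>2 + 1) * ?S"
    using norm_rotate[OF t] norm_rotate[OF u] norm_rotate[OF v] norm_rotate[OF w]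
    by (simp add: distrib_left)
  show ?case
  proof (rule ccontr)
    assume "?S \<noteq> 0"
    moreover have "?S \<ge> 0" "?S' \<ge> 0"
      by auto
    ultimately have pos: "?S > 0"
      by linarith
    \<comment> \<open>From \<open>j \<le> p - 1\<close> follows
      \<open>j^2 + 1 \<le> p^2 - 2 p + 2\<close>, which is below \<open>p^2\<close> as
      \<open>p > 1\<close>.\<close>
    have "j * j \<le> (p - 1) * (p - 1)"
      using j by (intro mult_mono) auto
    moreover have "p > 1"
      using p(1) prime_gt_1_int by blast
    ultimately have "j\<^sup>2 + 1 < p\<^sup>2"
      by (simp add: algebra_simps power2_eq_square)
    then have "p\<^sup>2 * ?S' < p\<^sup>2 * ?S"
      unfolding S using pos by (rule mult_strict_right_mono)
    then have lt: "?S' < ?S"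
      using p0 by simp
    \<comment> \<open>The induction hypothesis kills the smaller solution, and \<open>S\<close>
      carries this back to the original one.\<close>
    then have "?S' = 0"
      using less.hyps[OF _ re' im'] pos by simp
    then have "(j\<^sup>2 + 1) * ?S = 0"
      using S by simp
    moreover have "j\<^sup>2 + 1 > 0"
      by (simp add: add_nonneg_pos)
    ultimately show False
      using pos by simp
  qed
qed


section \<open>The norm form over the Gaussian numbers\<close>

lemma Gauss_numbers_denominator:
  assumes "z \<in> Gauss_numbers"
  obtains d m n :: int where "d \<noteq> 0" "of_int d * z = Complex (of_int m) (of_int n)"
proof -
  have "Re z \<in> \<rat>" "Im z \<in> \<rat>"
    using assms by (auto simp: Gauss_numbers_iff)
  then obtain a b c d where "b > 0" "Re z = of_int a / of_int b" "d > 0" "Im z = of_int c / of_int d"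
    by (metis Rats_cases')
  then have "of_int (b * d) * z = Complex (of_int (a * d)) (of_int (c * b))" "b * d \<noteq> 0"
    by (auto simp: complex_eq_iff)
  then show ?thesis
    using that by blast
qed

lemma norm_form_anisotropic:
  fixes p :: nat and \<alpha> :: int
  assumes p: "Factorial_Ring.prime p" "[p = 1] (mod 4)" and nr: "\<not> QuadRes (int p) \<alpha>"
    and G: "t \<in> Gauss_numbers" "u \<in> Gauss_numbers" "v \<in> Gauss_numbers" "w \<in> Gauss_numbers"
    and eq: "t\<^sup>2 - of_int \<alpha> * u\<^sup>2 = of_nat p * (v\<^sup>2 - of_int \<alpha> * w\<^sup>2)"
  shows "t = 0 \<and> u = 0 \<and> v = 0 \<and> w = 0"
proof -
  obtain dt t1 t2 where t: "dt \<noteq> 0" "of_int dt * t = Complex (of_int t1) (of_int t2)"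
    using Gauss_numbers_denominator[OF G(1)] .
  obtain du u1 u2 where u: "du \<noteq> 0" "of_int du * u = Complex (of_int u1) (of_int u2)"
    using Gauss_numbers_denominator[OF G(2)] .
  obtain dv v1 v2 where v: "dv \<noteq> 0" "of_int dv * v = Complex (of_int v1) (of_int v2)"
    using Gauss_numbers_denominator[OF G(3)] .
  obtain dw w1 w2 where w: "dw \<noteq> 0" "of_int dw * w = Complex (of_int w1) (of_int w2)"
    using Gauss_numbers_denominator[OF G(4)] .
  define D where "D = dt * du * dv * dw"
  have D0: "D \<noteq> 0"
    using t u v w by (simp add: D_def)
  have scale: "\<exists>m n. of_int D * z = Complex (of_int m) (of_int n)"
    if "of_int d * z = Complex (of_int m) (of_int n)" "D = e * d" for d e z m n
  proof -
    have "of_int D * z = Complex (of_int (e * m)) (of_int (e * n))"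
      using that by (simp add: mult.assoc complex_eq_iff)
    then show ?thesis by blast
  qed
  \<comment> \<open>The numerators are rebound over the common denominator \<open>D\<close>, so that
    the homogeneous equation can be multiplied by \<open>D^2\<close>.\<close>
  obtain t1 t2 where t: "of_int D * t = Complex (of_int t1) (of_int t2)"
    using scale[OF t(2), of "du * dv * dw"] by (auto simp: D_def ac_simps)
  obtain u1 u2 where u: "of_int D * u = Complex (of_int u1) (of_int u2)"
    using scale[OF u(2), of "dt * dv * dw"] by (auto simp: D_def ac_simps)
  obtain v1 v2 where v: "of_int D * v = Complex (of_int v1) (of_int v2)"
    using scale[OF v(2), of "dt * du * dw"] by (auto simp: D_def ac_simps)
  obtain w1 w2 where w: "of_int D * w = Complex (of_int w1) (of_int w2)"
    using scale[OF w(2), of "dt * du * dv"] by (auto simp: D_def ac_simps)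
  have "(of_int D)\<^sup>2 * (t\<^sup>2 - of_int \<alpha> * u\<^sup>2)
      = (of_int D)\<^sup>2 * (of_nat p * (v\<^sup>2 - of_int \<alpha> * w\<^sup>2))"
    by (simp only: eq)
  then have "(of_int D * t)\<^sup>2 - of_int \<alpha> * (of_int D * u)\<^sup>2
      = of_nat p * ((of_int D * v)\<^sup>2 - of_int \<alpha> * (of_int D * w)\<^sup>2)"
    by (simp add: algebra_simps power2_eq_square)
  then have *: "(Complex (of_int t1) (of_int t2))\<^sup>2 - of_int \<alpha> * (Complex (of_int u1) (of_int u2))\<^sup>2
      = of_nat p * ((Complex (of_int v1) (of_int v2))\<^sup>2
        - of_int \<alpha> * (Complex (of_int w1) (of_int w2))\<^sup>2)"
    unfolding t u v w .
  have "real_of_int (form_re \<alpha> t1 t2 u1 u2) = real_of_int (int p * form_re \<alpha> v1 v2 w1 w2)"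
    using arg_cong[OF *, of Re] by (simp add: form_re_def power2_eq_square)
  then have re: "form_re \<alpha> t1 t2 u1 u2 = int p * form_re \<alpha> v1 v2 w1 w2"
    by linarith
  have "2 * real_of_int (form_im \<alpha> t1 t2 u1 u2) = 2 * real_of_int (int p * form_im \<alpha> v1 v2 w1 w2)"
    using arg_cong[OF *, of Im] by (simp add: form_im_def power2_eq_square algebra_simps)
  then have im: "form_im \<alpha> t1 t2 u1 u2 = int p * form_im \<alpha> v1 v2 w1 w2"
    by linarith
  have "odd p"
    using p(2) by (auto simp: cong_def elim!: evenE) presburger
  moreover obtain j where "0 \<le> j" "j < int p" "int p dvd j\<^sup>2 + 1"
    using sqrt_minus_one_mod_prime[OF p] .
  ultimately have "t1\<^sup>2 + t2\<^sup>2 + (u1\<^sup>2 + u2\<^sup>2) + (v1\<^sup>2 + v2\<^sup>2) + (w1\<^sup>2 + w2\<^sup>2) = 0"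
    using form_anisotropic[OF _ _ nr _ _ _ re im, of j] p(1) by simp
  then have "t1 = 0 \<and> t2 = 0 \<and> u1 = 0 \<and> u2 = 0 \<and> v1 = 0 \<and> v2 = 0 \<and> w1 = 0 \<and> w2 = 0"
    by (simp add: add_nonneg_eq_0_iff)
  then show ?thesis
    using t u v w D0 by (simp add: zero_complex.code[symmetric])
qed


section \<open>Quaternion algebras as images of the coordinate model\<close>

text \<open>Isolates the generators and relations, with arbitrary Gaussian numbers as parameters,
  for computing inside \<open>A\<close>.\<close>

locale quaternion_generators = ring A
  for A :: "('a, 'm) ring_scheme" (structure) +
  fixes \<phi> :: "complex \<Rightarrow> 'a" and a b :: complex and x y :: 'a
  assumes hom: "\<phi> \<in> ring_hom Q_i A"
    and central: "\<phi> ` Gauss_numbers \<subseteq> center A"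
    and a: "a \<in> Gauss_numbers" and b: "b \<in> Gauss_numbers"
    and x [simp]: "x \<in> carrier A" and y [simp]: "y \<in> carrier A"
    and xx: "x \<otimes> x = \<phi> a" and yy: "y \<otimes> y = \<phi> b" and yx: "y \<otimes> x = \<ominus> (x \<otimes> y)"
    and generated: "generate_ring A (\<phi> ` Gauss_numbers \<union> {x, y}) = carrier A"
begin

definition lincomb :: "complex \<times> complex \<times> complex \<times> complex \<Rightarrow> 'a" where
  "lincomb = (\<lambda>(t, u, v, w). \<phi> t \<oplus> \<phi> u \<otimes> x \<oplus> \<phi> v \<otimes> y \<oplus> \<phi> w \<otimes> (x \<otimes> y))"

section \<open>Arithmetic of the central scalars\<close>

lemma phi_closed [simp]: "c \<in> Gauss_numbers \<Longrightarrow> \<phi> c \<in> carrier A"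
  using ring_hom_closed[OF hom] by simp

lemma phi_mult: "c \<in> Gauss_numbers \<Longrightarrow> d \<in> Gauss_numbers \<Longrightarrow> \<phi> (c * d) = \<phi> c \<otimes> \<phi> d"
  using ring_hom_mult[OF hom, of c d] by simp

lemma phi_add: "c \<in> Gauss_numbers \<Longrightarrow> d \<in> Gauss_numbers \<Longrightarrow> \<phi> (c + d) = \<phi> c \<oplus> \<phi> d"
  using ring_hom_add[OF hom, of c d] by simp

lemma phi_one [simp]: "\<phi> 1 = \<one>"
  using ring_hom_one[OF hom] by simp

lemma phi_zero [simp]: "\<phi> 0 = \<zero>"
proof -
  have "\<phi> 0 \<oplus> \<phi> 0 = \<phi> 0"
    using phi_add[of 0 0] by simp
  then show ?thesis
    using add.r_cancel_one' [of "\<phi> 0" "\<phi> 0"] by simp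
qed

lemma phi_uminus: "c \<in> Gauss_numbers \<Longrightarrow> \<phi> (- c) = \<ominus> \<phi> c"
  using phi_add[of "- c" c] by (intro minus_equality[symmetric]) auto

lemma phi_commute: "c \<in> Gauss_numbers \<Longrightarrow> z \<in> carrier A \<Longrightarrow> z \<otimes> \<phi> c = \<phi> c \<otimes> z"
  using central by (auto simp: center_def)

lemma phi_left_commute:
  "c \<in> Gauss_numbers \<Longrightarrow> z \<in> carrier A \<Longrightarrow> z' \<in> carrier A \<Longrightarrow> z \<otimes> (\<phi> c \<otimes> z') = \<phi> c \<otimes> (z \<otimes> z')"
  by (simp add: m_assoc[symmetric] phi_commute)

section \<open>The coordinate map as a surjective homomorphism\<close>

lemma lincomb_closed: "q \<in> carrier (quat a b) \<Longrightarrow> lincomb q \<in> carrier A"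
  by (auto simp: lincomb_def)

lemma lincomb_of: "c \<in> Gauss_numbers \<Longrightarrow> lincomb (quat_of c) = \<phi> c"
  by (simp add: lincomb_def quat_of_def)

lemma lincomb_add:
  assumes "q \<in> carrier (quat a b)" "q' \<in> carrier (quat a b)"
  shows "lincomb (quat_add q q') = lincomb q \<oplus> lincomb q'"
  using assms by (auto simp: lincomb_def phi_add l_distr a_ac)

lemma lincomb_scale:
  assumes "c \<in> Gauss_numbers" "q \<in> carrier (quat a b)"
  shows "\<phi> c \<otimes> lincomb q = lincomb (quat_mult a b (quat_of c) q)"
  using assms by (auto simp: lincomb_def quat_of_def phi_mult r_distr m_assoc)

lemma lincomb_x:
  assumes "q \<in> carrier (quat a b)"
  shows "x \<otimes> lincomb q = lincomb (quat_mult a b (0, 1, 0, 0) q)"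
proof -
  obtain t u v w where q: "q = (t, u, v, w)"
    "t \<in> Gauss_numbers" "u \<in> Gauss_numbers" "v \<in> Gauss_numbers" "w \<in> Gauss_numbers"
    using assms by auto
  have xxy: "x \<otimes> (x \<otimes> y) = \<phi> a \<otimes> y"
    by (simp add: m_assoc[symmetric] xx)
  have phi_a: "\<phi> (a * c) = \<phi> c \<otimes> \<phi> a" if "c \<in> Gauss_numbers" for c
    using phi_mult[OF that a] by (simp add: mult.commute)
  have "x \<otimes> lincomb q = \<phi> t \<otimes> x \<oplus> \<phi> u \<otimes> \<phi> a \<oplus> \<phi> v \<otimes> (x \<otimes> y) \<oplus> \<phi> w \<otimes> (\<phi> a \<otimes> y)"
    using q by (simp add: lincomb_def r_distr phi_commute[of _ x] phi_left_commute[of _ x] xx xxy)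
  also have "\<dots> = lincomb (quat_mult a b (0, 1, 0, 0) q)"
    using q a by (simp add: lincomb_def phi_a m_assoc a_ac)
  finally show ?thesis .
qed

lemma lincomb_y:
  assumes "q \<in> carrier (quat a b)"
  shows "y \<otimes> lincomb q = lincomb (quat_mult a b (0, 0, 1, 0) q)"
proof -
  obtain t u v w where q: "q = (t, u, v, w)"
    "t \<in> Gauss_numbers" "u \<in> Gauss_numbers" "v \<in> Gauss_numbers" "w \<in> Gauss_numbers"
    using assms by auto
  \<comment> \<open>Anticommuting the first two factors gives \<open>- x y^2\<close>, and the scalar
    \<open>\<phi> b\<close> is central.\<close>
  have yxy: "y \<otimes> (x \<otimes> y) = \<ominus> (\<phi> b \<otimes> x)"
    using b by (simp add: m_assoc[symmetric] yx l_minus) (simp add: m_assoc yy phi_commute)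
  have phi_b: "\<phi> (b * c) = \<phi> c \<otimes> \<phi> b" if "c \<in> Gauss_numbers" for c
    using phi_mult[OF that b] by (simp add: mult.commute)
  have "y \<otimes> lincomb q = \<phi> t \<otimes> y \<oplus> \<ominus> (\<phi> u \<otimes> (x \<otimes> y)) \<oplus> \<phi> v \<otimes> \<phi> b \<oplus> \<ominus> (\<phi> w \<otimes> (\<phi> b \<otimes> x))"
    using q b by (simp add: lincomb_def r_distr phi_commute[of _ y] phi_left_commute[of _ y]
        yx yy yxy r_minus)
  also have "\<dots> = lincomb (quat_mult a b (0, 0, 1, 0) q)"
    using q b by (simp add: lincomb_def phi_b phi_uminus m_assoc a_ac l_minus)
  finally show ?thesis .
qed

text \<open>Left multiplication by \<open>q\<close> is composed of left multiplications by scalars,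
  \<open>x\<close> and \<open>y\<close>, each already known to match the model. This avoids
  expanding sixteen products in \<open>A\<close>.\<close>

lemma lincomb_mult:
  assumes q: "q \<in> carrier (quat a b)" and q': "q' \<in> carrier (quat a b)"
  shows "lincomb q \<otimes> lincomb q' = lincomb (quat_mult a b q q')"
proof -
  interpret Q: ring "quat a b"
    using ring_quat a b by blast
  obtain t u v w where tuvw: "q = (t, u, v, w)"
    "t \<in> Gauss_numbers" "u \<in> Gauss_numbers" "v \<in> Gauss_numbers" "w \<in> Gauss_numbers"
    using q by auto
  let ?x = "(0, 1, 0, 0)" and ?y = "(0, 0, 1, 0)"
  let ?m = "quat_mult a b"
  have closed: "?m r s \<in> carrier (quat a b)" "quat_add r s \<in> carrier (quat a b)"
    if "r \<in> carrier (quat a b)" "s \<in> carrier (quat a b)" for r s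
    using Q.m_closed[OF that] Q.a_closed[OF that] by simp_all
  have gens: "?x \<in> carrier (quat a b)" "?y \<in> carrier (quat a b)"
    "c \<in> Gauss_numbers \<Longrightarrow> quat_of c \<in> carrier (quat a b)" for c
    by (auto simp: quat_of_def)
  have "lincomb q \<otimes> lincomb q' = \<phi> t \<otimes> lincomb q' \<oplus> \<phi> u \<otimes> (x \<otimes> lincomb q')
      \<oplus> \<phi> v \<otimes> (y \<otimes> lincomb q') \<oplus> \<phi> w \<otimes> (x \<otimes> (y \<otimes> lincomb q'))"
    using tuvw lincomb_closed[OF q'] unfolding lincomb_def
    by (simp add: l_distr m_assoc)
  also have "\<dots> = lincomb (?m (quat_of t) q') \<oplus> lincomb (?m (quat_of u) (?m ?x q'))
      \<oplus> lincomb (?m (quat_of v) (?m ?y q')) \<oplus> lincomb (?m (quat_of w) (?m ?x (?m ?y q')))"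
    using tuvw q' gens closed by (simp only: lincomb_scale lincomb_x lincomb_y)
  also have "\<dots> = lincomb (quat_add (quat_add (quat_add (?m (quat_of t) q')
      (?m (quat_of u) (?m ?x q'))) (?m (quat_of v) (?m ?y q'))) (?m (quat_of w) (?m ?x (?m ?y q'))))"
    using tuvw q' gens closed by (simp only: lincomb_add)
  \<comment> \<open>What remains is an identity of complex coordinates in the model.\<close>
  also have "quat_add (quat_add (quat_add (?m (quat_of t) q') (?m (quat_of u) (?m ?x q')))
      (?m (quat_of v) (?m ?y q'))) (?m (quat_of w) (?m ?x (?m ?y q'))) = ?m q q'"
    by (cases q') (simp add: tuvw quat_of_def algebra_simps)
  finally show ?thesis .
qed

text \<open>The image contains the generators and is closed under the ring operations, by induction
  on \<open>generate_ring\<close>.\<close>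

lemma lincomb_surj: "lincomb ` carrier (quat a b) = carrier A"
proof
  show "lincomb ` carrier (quat a b) \<subseteq> carrier A"
    using lincomb_closed by blast
  interpret Q: ring "quat a b"
    using ring_quat a b by blast
  show "carrier A \<subseteq> lincomb ` carrier (quat a b)"
  proof
    fix z assume "z \<in> carrier A"
    then have "z \<in> generate_ring A (\<phi> ` Gauss_numbers \<union> {x, y})"
      by (simp only: generated)
    then show "z \<in> lincomb ` carrier (quat a b)"
    proof induction
      case one
      show ?case
        using lincomb_of[of 1] by (intro image_eqI[of _ _ "quat_of 1"]) (auto simp: quat_of_def)
    next
      case (incl h)
      then consider c where "c \<in> Gauss_numbers" "h = \<phi> c" | "h = x" | "h = y"
        by auto
      then show ?case
      proof cases
        case 1
        then show ?thesis
          by (intro image_eqI[of _ _ "quat_of c"]) (simp_all add: lincomb_of, simp add: quat_of_def)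
      next
        case 2
        then show ?thesis
          by (intro image_eqI[of _ _ "(0, 1, 0, 0)"]) (auto simp: lincomb_def)
      next
        case 3
        then show ?thesis
          by (intro image_eqI[of _ _ "(0, 0, 1, 0)"]) (auto simp: lincomb_def)
      qed
    next
      case (a_inv h)
      then obtain q where q: "q \<in> carrier (quat a b)" "h = lincomb q"
        by blast
      have "\<ominus> h = \<phi> (- 1) \<otimes> h"
        using q lincomb_closed[OF q(1)] by (simp add: phi_uminus l_minus)
      also have "\<dots> = lincomb (quat_of (- 1) \<otimes>\<^bsub>quat a b\<^esub> q)"
        using lincomb_scale[OF _ q(1), of "- 1"] q by simp
      finally show ?case
        using q(1) by (auto simp del: quat_simps intro!: imageI) (auto simp: quat_of_def)
    next
      case (eng_add h k)
      then obtain q r where "q \<in> carrier (quat a b)" "h = lincomb q"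
        "r \<in> carrier (quat a b)" "k = lincomb r"
        by blast
      then show ?case
        using lincomb_add[of q r] Q.a_closed[of q r]
        by (intro image_eqI[of _ _ "quat_add q r"]) auto
    next
      case (eng_mult h k)
      then obtain q r where "q \<in> carrier (quat a b)" "h = lincomb q"
        "r \<in> carrier (quat a b)" "k = lincomb r"
        by blast
      then show ?case
        using lincomb_mult[of q r] Q.m_closed[of q r]
        by (intro image_eqI[of _ _ "quat_mult a b q r"]) auto
    qed
  qed
qed

text \<open>A preimage \<open>q\<close> of \<open>z\<close> has nonzero reduced norm, so its
  conjugate divided by the norm inverts it in the model; the homomorphism carries this to
  \<open>A\<close>.\<close>

lemma units_if_anisotropic:
  assumes aniso: "\<And>t u v w. \<lbrakk>t \<in> Gauss_numbers; u \<in> Gauss_numbers; v \<in> Gauss_numbers;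
      w \<in> Gauss_numbers; t\<^sup>2 - a * u\<^sup>2 = b * (v\<^sup>2 - a * w\<^sup>2)\<rbrakk> \<Longrightarrow> t = 0 \<and> u = 0 \<and> v = 0 \<and> w = 0"
    and z: "z \<in> carrier A" "z \<noteq> \<zero>"
  shows "z \<in> Units A"
proof -
  obtain q where q: "q \<in> carrier (quat a b)" "z = lincomb q"
    using z(1) lincomb_surj by blast
  obtain t u v w where tuvw: "q = (t, u, v, w)"
    "t \<in> Gauss_numbers" "u \<in> Gauss_numbers" "v \<in> Gauss_numbers" "w \<in> Gauss_numbers"
    using q by auto
  \<comment> \<open>The reduced norm: \<open>q\<close> times its conjugate
    \<open>(t, - u, - v, - w)\<close> is the scalar \<open>N\<close>.\<close>
  define N where "N = t\<^sup>2 - a * u\<^sup>2 - b * (v\<^sup>2 - a * w\<^sup>2)"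
  have "N \<noteq> 0"
  proof
    assume "N = 0"
    then have "q = (0, 0, 0, 0)"
      using aniso[of t u v w] tuvw by (simp add: N_def)
    then show False
      using z(2) q(2) by (simp add: lincomb_def)
  qed
  have "N \<in> Gauss_numbers"
    using tuvw a b by (simp add: N_def power2_eq_square)
  define q' where "q' = (t / N, - u / N, - v / N, - w / N)"
  have q': "q' \<in> carrier (quat a b)"
    using tuvw \<open>N \<in> Gauss_numbers\<close> by (simp add: q'_def)
  have N: "(t * t - a * u * u - b * v * v + a * b * w * w) / N = 1"
    using \<open>N \<noteq> 0\<close> by (simp add: N_def algebra_simps power2_eq_square)
  have "quat_mult a b q q' = (1, 0, 0, 0)" "quat_mult a b q' q = (1, 0, 0, 0)"
    using N by (simp_all add: tuvw q'_def algebra_simps add_divide_distrib diff_divide_distrib)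
  then have "z \<otimes> lincomb q' = \<one>" "lincomb q' \<otimes> z = \<one>"
    using lincomb_mult[OF q(1) q'] lincomb_mult[OF q' q(1)] lincomb_of[of 1] q(2)
    by (simp_all add: quat_of_def)
  then show ?thesis
    using z(1) lincomb_closed[OF q'] by (auto simp: Units_def)
qed

end

theorem theorem3p1:
  fixes p :: nat and \<alpha> :: int
    and A :: "('a, 'm) ring_scheme" and \<phi> :: "complex \<Rightarrow> 'a"
  assumes "Factorial_Ring.prime p" and "[p = 1] (mod 4)"
    and "\<not> QuadRes (int p) \<alpha>"
    and "quaternion_algebra Q_i (of_int \<alpha>) (of_nat p) A \<phi>"
  shows "division_algebra Q_i A \<phi>"
proof -
  have alg: "assoc_algebra Q_i A \<phi>" and one: "\<one>\<^bsub>A\<^esub> \<noteq> \<zero>\<^bsub>A\<^esub>"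
    using assms(4)
    by (auto simp: quaternion_algebra_def central_simple_algebra_def simple_ring_def)
  interpret ring A
    using alg by (simp add: assoc_algebra_def)
  obtain x y where "x \<in> carrier A" "y \<in> carrier A"
    "x [^]\<^bsub>A\<^esub> (2::nat) = \<phi> (of_int \<alpha>)" "y [^]\<^bsub>A\<^esub> (2::nat) = \<phi> (of_nat p)"
    "y \<otimes>\<^bsub>A\<^esub> x = \<ominus>\<^bsub>A\<^esub> (x \<otimes>\<^bsub>A\<^esub> y)"
    "generate_ring A (\<phi> ` carrier Q_i \<union> {x, y}) = carrier A"
    using assms(4) unfolding quaternion_algebra_def by blast
  then interpret quaternion_generators A \<phi> "of_int \<alpha>" "of_nat p" x y
    using alg by unfold_locales (auto simp: assoc_algebra_def numeral_2_eq_2)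
  have "z \<in> Units A" if "z \<in> carrier A" "z \<noteq> \<zero>\<^bsub>A\<^esub>" for z
    using norm_form_anisotropic[OF assms(1-3)] that by (intro units_if_anisotropic)
  \<comment> \<open>If zero had an inverse, then \<open>\<one> = \<zero>\<close>, contrary to the
    simplicity of \<open>A\<close>.\<close>
  moreover have "\<zero>\<^bsub>A\<^esub> \<notin> Units A"
    using one by (auto simp: Units_def)
  ultimately have "Units A = carrier A - {\<zero>\<^bsub>A\<^esub>}"
    by (auto simp: Units_def)
  then show ?thesis
    using alg one by (simp add: division_algebra_def)
qed

end
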